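(* Let $b>a>0$. Then for all real $p,q>1$ with $\frac1p+\frac1q=1$, $$\left|\frac{1}{H(a,b)}-\frac{1}{L(a,b)}\right|\le\frac{(b-a)^{2}}{(p+1)^{1/p}(q+2)^{1/q}}\left[\frac{1}{a^{3q}}+\frac{1}{(q+1)b^{3q}}\right]^{1/q}.$$
   Context: For positive reals $\alpha\ne\beta$, $H(\alpha,\beta)=\frac{2}{1/\alpha+1/\beta}$ is the harmonic mean and $L(\alpha,\beta)=\frac{\alpha-\beta}{\ln\alpha-\ln\beta}$ is the logarithmic mean. *)

theory Defs
  imports Complex_Main
begin

text \<open>Both means are meant for distinct positive reals. Off that domain the formulas follow the
  HOL conventions for division by zero and \<open>ln\<close>; in particular \<open>logarithmic_mean x x = 0\<close>, not \<open>x\<close>.\<close>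

definition harmonic_mean :: "real \<Rightarrow> real \<Rightarrow> real" where
  "harmonic_mean \<alpha> \<beta> = 2 / (1 / \<alpha> + 1 / \<beta>)"

definition logarithmic_mean :: "real \<Rightarrow> real \<Rightarrow> real" where
  "logarithmic_mean \<alpha> \<beta> = (\<alpha> - \<beta>) / (ln \<alpha> - ln \<beta>)"

end

theory Submission
  imports Defs "HOL-Analysis.Convex"
begin

text \<open>
  With \<open>x = b / a > 1\<close> the difference of the reciprocal means is
  \<open>((x - 1/x) / 2 - ln x) / (b - a)\<close>. It is the error of the trapezoidal rule for \<open>1/t\<close> on
  \<open>[a, b]\<close>, and lies between \<open>0\<close> and \<open>(b - a)\<^sup>2 / (6 * a^3)\<close>: the numerator vanishes at
  \<open>x = 1\<close> and has derivative \<open>(x - 1)\<^sup>2 / (2 * x\<^sup>2)\<close>, which is between \<open>0\<close> and \<open>(x - 1)\<^sup>2 / 2\<close>.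

  The right-hand side of the theorem is what Hoelder's inequality and the convexity of
  \<open>t \<mapsto> t powr (- 3 * q)\<close> yield for that error, but it is generous enough to be compared with this
  elementary bound directly. Discarding the term with \<open>b\<close> leaves \<open>1 / a^3\<close> as the last factor, and the
  weighted inequality of arithmetic and geometric means, with weights \<open>1/p\<close> and \<open>1/q\<close>, bounds
  \<open>(p + 1) powr (1/p) * (q + 2) powr (1/q)\<close> by \<open>(p + 1)/p + (q + 2)/q = 3 + 1/q < 4\<close>. So
  the right-hand side is at least \<open>(b - a)\<^sup>2 / (4 * a^3)\<close>.
\<close>

text \<open>
  Both bounds come from integrating \<open>0 \<le> (t - 1)\<^sup>2 / (2 * t\<^sup>2) \<le> (t - 1)\<^sup>2 / 2\<close> from \<open>1\<close> to \<open>x\<close>;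
  the middle term is the derivative of \<open>(t - 1/t) / 2 - ln t\<close>.
\<close>

lemma ln_trapezoid_bounds:
  fixes x :: real
  assumes "x \<ge> 1"
  shows "0 \<le> (x - 1 / x) / 2 - ln x" and "(x - 1 / x) / 2 - ln x \<le> (x - 1) ^ 3 / 6"
proof -
  define h where "h = (\<lambda>t::real. (t - 1 / t) / 2 - ln t)"
  have dh: "(h has_real_derivative (t - 1)\<^sup>2 / (2 * t\<^sup>2)) (at t)" if "t \<ge> 1" for t
    unfolding h_def using that
    by (auto intro!: derivative_eq_intros simp: field_simps power2_eq_square)
  have "h 1 \<le> h x"
  proof (rule DERIV_nonneg_imp_nondecreasing[OF assms])
    fix t :: real assume "1 \<le> t"
    then show "\<exists>y. (h has_real_derivative y) (at t) \<and> 0 \<le> y"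
      using dh by (intro exI[of _ "(t - 1)\<^sup>2 / (2 * t\<^sup>2)"]) auto
  qed
  then show "0 \<le> (x - 1 / x) / 2 - ln x"
    by (simp add: h_def)
  define g where "g = (\<lambda>t::real. (t - 1) ^ 3 / 6 - h t)"
  have "g 1 \<le> g x"
  proof (rule DERIV_nonneg_imp_nondecreasing[OF assms])
    fix t :: real assume t: "1 \<le> t"
    have "(g has_real_derivative (t - 1)\<^sup>2 / 2 - (t - 1)\<^sup>2 / (2 * t\<^sup>2)) (at t)"
      unfolding g_def by (auto intro!: derivative_eq_intros dh[OF t] simp: field_simps)
    moreover have "(t - 1)\<^sup>2 / (2 * t\<^sup>2) \<le> (t - 1)\<^sup>2 / 2"
      using t by (intro divide_left_mono) (auto simp: one_le_power)
    ultimately show "\<exists>y. (g has_real_derivative y) (at t) \<and> 0 \<le> y"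
      by (metis diff_ge_0_iff_ge)
  qed
  then show "(x - 1 / x) / 2 - ln x \<le> (x - 1) ^ 3 / 6"
    by (simp add: g_def h_def)
qed

text \<open>
  Substituting \<open>x = b / a\<close> makes the left-hand side \<open>((x - 1/x) / 2 - ln x) / (b - a)\<close>. The
  constant \<open>6\<close> is best possible: the two sides are asymptotically equal as \<open>b\<close> tends to \<open>a\<close>.
\<close>

lemma harmonic_logarithmic_mean_inverse_diff:
  fixes a b :: real
  assumes "b > a" and "a > 0"
  shows "\<bar>1 / harmonic_mean a b - 1 / logarithmic_mean a b\<bar> \<le> (b - a)\<^sup>2 / (6 * a ^ 3)"
proof -
  define x where "x = b / a"
  have x: "x > 1" and b: "b = a * x"
    using assms by (auto simp: x_def)
  have ln_b: "ln b = ln a + ln x"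
    using assms x by (simp add: b ln_mult)
  have eq: "1 / harmonic_mean a b - 1 / logarithmic_mean a b
      = ((x - 1 / x) / 2 - ln x) / (b - a)"
  proof -
    have L: "1 / logarithmic_mean a b = ln x / (b - a)"
      unfolding logarithmic_mean_def ln_b using assms by (simp add: field_simps)
    have "1 / harmonic_mean a b = ((x - 1 / x) / 2) / (b - a)"
      unfolding harmonic_mean_def b using assms x by (simp add: field_simps)
    then show ?thesis
      using L by (simp add: diff_divide_distrib)
  qed
  have "(x - 1) ^ 3 / 6 / (b - a) = (b - a)\<^sup>2 / (6 * a ^ 3)"
  proof -
    have "x - 1 = (b - a) / a"
      using assms by (simp add: x_def field_simps)
    then show ?thesis
      using assms by (simp add: power_divide power2_eq_square power3_eq_cube)
  qed
  moreover have "((x - 1 / x) / 2 - ln x) / (b - a) \<le> (x - 1) ^ 3 / 6 / (b - a)"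
    using ln_trapezoid_bounds(2)[of x] x assms by (intro divide_right_mono) auto
  moreover have "0 \<le> ((x - 1 / x) / 2 - ln x) / (b - a)"
    using ln_trapezoid_bounds(1)[of x] x assms by (intro divide_nonneg_nonneg) auto
  ultimately show ?thesis
    unfolding eq by linarith
qed

lemma conjugate_exponents_powr_less:
  fixes p q :: real
  assumes "p > 1" and "q > 1" and "1 / p + 1 / q = 1"
  shows "(p + 1) powr (1 / p) * (q + 2) powr (1 / q) < 4"
proof -
  have "(p + 1) powr (1 / p) * (q + 2) powr (1 / q) \<le> 1 / p * (p + 1) + 1 / q * (q + 2)"
    using assms by (intro Youngs_inequality_0) auto
  also have "\<dots> = 2 + (1 / p + 1 / q) + 1 / q"
    using assms(1,2) by (simp add: field_simps)
  also have "\<dots> < 4"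
    using assms by simp
  finally show ?thesis .
qed

theorem theorem4p4:
  fixes a b p q :: real
  assumes "b > a" and "a > 0"
    and "p > 1" and "q > 1" and "1 / p + 1 / q = 1"
  shows "\<bar>1 / harmonic_mean a b - 1 / logarithmic_mean a b\<bar>
    \<le> (b - a)\<^sup>2 / ((p + 1) powr (1 / p) * (q + 2) powr (1 / q))
      * (1 / a powr (3 * q) + 1 / ((q + 1) * b powr (3 * q))) powr (1 / q)"
proof -
  let ?C = "(p + 1) powr (1 / p) * (q + 2) powr (1 / q)"
  let ?S = "1 / a powr (3 * q) + 1 / ((q + 1) * b powr (3 * q))"
  have "(1 / a powr (3 * q)) powr (1 / q) = 1 / a ^ 3"
    using assms by (simp add: powr_divide powr_powr)
  moreover have "(1 / a powr (3 * q)) powr (1 / q) \<le> ?S powr (1 / q)"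
    using assms by (intro powr_mono2) auto
  ultimately have S: "1 / a ^ 3 \<le> ?S powr (1 / q)"
    by simp
  have C: "(b - a)\<^sup>2 / 6 \<le> (b - a)\<^sup>2 / ?C"
    using conjugate_exponents_powr_less[OF assms(3-5)] assms by (intro divide_left_mono) auto
  have "\<bar>1 / harmonic_mean a b - 1 / logarithmic_mean a b\<bar> \<le> (b - a)\<^sup>2 / 6 * (1 / a ^ 3)"
    using harmonic_logarithmic_mean_inverse_diff[OF assms(1,2)] by simp
  also have "\<dots> \<le> (b - a)\<^sup>2 / ?C * ?S powr (1 / q)"
    using S C assms by (intro mult_mono) auto
  finally show ?thesis .
qed

end
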